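(* Let $\{\langle E_i,\nu_i\rangle\}_{i=1}^n$ be a finite family of locally convex spaces, where $\nu_i=\{\nu_{i,l_i}:l_i\in L_i\}$ is a fundamental directed set of seminorms of $E_i$. Let $\Pr_i:\prod_{k=1}^nE_k\to E_i$ be the canonical projection, and for $i=1,\dots,n$, $l_i\in L_i$ and $\rho\in\prod_{i=1}^nL_i$ set $$\hat\nu_{i,l_i}=\nu_{i,l_i}\circ\Pr_i,\qquad \hat\mu_\rho=\sum_{k=1}^n\hat\nu_{k,\rho_k}.$$ Then $\hat\mu=\{\hat\mu_\rho:\rho\in\prod_{i=1}^nL_i\}$ is a directed set of seminorms on $\bigoplus_{i=1}^nE_i$. Moreover, setting $W^\rho_\varepsilon=\{x\in\bigoplus_{i=1}^nE_i:\hat\mu_\rho(x)<\varepsilon\}$ and $\mathcal B(\mathbf 0)=\{W_\varepsilon^\rho:\varepsilon>0,\ \rho\in\prod_{i=1}^nL_i\}$, the set $\mathcal B(\mathbf 0)$ is a base of the filter of neighbourhoods of $\mathbf 0$ for the unique locally convex topology $\tau$ on $\bigoplus_{i=1}^nE_i$ generated by $\hat\mu$. Finally $\tau=\tau_0=\tau_b=\tau_l=\tau_{\mathfrak l}$.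
   Context: A set of seminorms is directed if any two of its elements are dominated pointwise by a third element of the set. On $\bigoplus_{i=1}^nE_i=\prod_{i=1}^nE_i$: $\tau_0$ is the topology induced by the product topology; $\tau_b$ the topology induced by the box topology; $\tau_l$ the direct sum topology, i.e. the finest linear (vector space) topology making all canonical inclusions $E_i\to\bigoplus_iE_i$ continuous; $\tau_{\mathfrak l}$ the locally convex direct sum topology, i.e. the finest locally convex topology making all canonical inclusions continuous (equivalently the finest locally convex topology coarser than $\tau_l$). *)

theory Defs
  imports "HOL-Analysis.Analysis" "HOL-Algebra.Algebraic_Closure_Type"
begin

text \<open>
  The members of a family of vector spaces carry their own carriers and operations: they are
  modules in the sense of HOL-Algebra over the scalar field, viewed as a ring
  with full carrier. The sort \<^class>\<open>real_normed_field\<close> of the scalars covers exactly the real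
  and the complex field (with the usual absolute value as norm), by the Gelfand--Mazur theorem.
  The ring multiplication and unit that the record type \<^typ>\<open>('k, 'v) module\<close> inherits
  play no role.
\<close>

definition vspace :: "('k::real_normed_field, 'v) module \<Rightarrow> bool" where
  "vspace V \<longleftrightarrow> Module.module (ring_of_type_algebra :: 'k ring) V"

definition linear_topology ::
    "('k::real_normed_field, 'v) module \<Rightarrow> 'v topology \<Rightarrow> bool" where
  "linear_topology V T \<longleftrightarrow>
     vspace V \<and> topspace T = carrier V \<and>
     continuous_map (prod_topology T T) T (\<lambda>(x, y). x \<oplus>\<^bsub>V\<^esub> y) \<and>
     continuous_map (prod_topology (euclidean :: 'k topology) T) T (\<lambda>(a, x). a \<odot>\<^bsub>V\<^esub> x)"

definition convex_in :: "('k::real_normed_field, 'v) module \<Rightarrow> 'v set \<Rightarrow> bool" where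
  "convex_in V C \<longleftrightarrow>
     C \<subseteq> carrier V \<and>
     (\<forall>x\<in>C. \<forall>y\<in>C. \<forall>t::real. 0 \<le> t \<and> t \<le> 1 \<longrightarrow>
        (of_real (1 - t) \<odot>\<^bsub>V\<^esub> x) \<oplus>\<^bsub>V\<^esub> (of_real t \<odot>\<^bsub>V\<^esub> y) \<in> C)"

text \<open>Locally convex topologies are not required to be Hausdorff.\<close>

definition locally_convex_topology ::
    "('k::real_normed_field, 'v) module \<Rightarrow> 'v topology \<Rightarrow> bool" where
  "locally_convex_topology V T \<longleftrightarrow>
     linear_topology V T \<and> neighbourhood_base_at \<zero>\<^bsub>V\<^esub> (convex_in V) T"

definition seminorm_on ::
    "('k::real_normed_field, 'v) module \<Rightarrow> ('v \<Rightarrow> real) \<Rightarrow> bool" where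
  "seminorm_on V p \<longleftrightarrow>
     (\<forall>x\<in>carrier V. 0 \<le> p x) \<and>
     (\<forall>x\<in>carrier V. \<forall>y\<in>carrier V. p (x \<oplus>\<^bsub>V\<^esub> y) \<le> p x + p y) \<and>
     (\<forall>a::'k. \<forall>x\<in>carrier V. p (a \<odot>\<^bsub>V\<^esub> x) = norm a * p x)"

text \<open>As usual for directed sets, the empty set is excluded.\<close>

definition directed_seminorms ::
    "('k::real_normed_field, 'v) module \<Rightarrow> ('v \<Rightarrow> real) set \<Rightarrow> bool" where
  "directed_seminorms V S \<longleftrightarrow>
     S \<noteq> {} \<and> (\<forall>p\<in>S. seminorm_on V p) \<and>
     (\<forall>p\<in>S. \<forall>q\<in>S. \<exists>r\<in>S. \<forall>x\<in>carrier V. p x \<le> r x \<and> q x \<le> r x)"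

definition seminorm_ball ::
    "('k::real_normed_field, 'v) module \<Rightarrow> ('v \<Rightarrow> real) \<Rightarrow> 'v \<Rightarrow> real \<Rightarrow> 'v set" where
  "seminorm_ball V p x \<epsilon> = {y \<in> carrier V. p (y \<ominus>\<^bsub>V\<^esub> x) < \<epsilon>}"

definition seminorm_topology ::
    "('k::real_normed_field, 'v) module \<Rightarrow> ('v \<Rightarrow> real) set \<Rightarrow> 'v topology" where
  "seminorm_topology V S =
     topology_generated_by
       (insert (carrier V)
         {seminorm_ball V p x \<epsilon> | p x \<epsilon>. p \<in> S \<and> x \<in> carrier V \<and> 0 < \<epsilon>})"

definition fundamental_directed_seminorms ::
    "('k::real_normed_field, 'v) module \<Rightarrow> 'v topology \<Rightarrow> ('v \<Rightarrow> real) set \<Rightarrow> bool" where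
  "fundamental_directed_seminorms V T S \<longleftrightarrow>
     directed_seminorms V S \<and> T = seminorm_topology V S"

definition filter_base :: "'a filter \<Rightarrow> 'a set set \<Rightarrow> bool" where
  "filter_base F \<B> \<longleftrightarrow> (\<forall>P. eventually P F \<longleftrightarrow> (\<exists>B\<in>\<B>. \<forall>x\<in>B. P x))"

definition direct_sum ::
    "'i set \<Rightarrow> ('i \<Rightarrow> ('k::real_normed_field, 'a) module) \<Rightarrow> ('k, 'i \<Rightarrow> 'a) module" where
  "direct_sum I E =
     \<lparr> carrier = {x \<in> \<Pi>\<^sub>E i\<in>I. carrier (E i). finite {i \<in> I. x i \<noteq> \<zero>\<^bsub>E i\<^esub>}},
       monoid.mult = (\<lambda>x y. undefined), one = undefined,
       ring.zero = (\<lambda>i\<in>I. \<zero>\<^bsub>E i\<^esub>),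
       add = (\<lambda>x y. \<lambda>i\<in>I. x i \<oplus>\<^bsub>E i\<^esub> y i),
       smult = (\<lambda>a x. \<lambda>i\<in>I. a \<odot>\<^bsub>E i\<^esub> x i) \<rparr>"

definition dsum_inclusion ::
    "'i set \<Rightarrow> ('i \<Rightarrow> ('k::real_normed_field, 'a) module) \<Rightarrow> 'i \<Rightarrow> 'a \<Rightarrow> 'i \<Rightarrow> 'a" where
  "dsum_inclusion I E j v = (\<lambda>i\<in>I. if i = j then v else \<zero>\<^bsub>E i\<^esub>)"

definition proj :: "'i \<Rightarrow> ('i \<Rightarrow> 'a) \<Rightarrow> 'a" where
  "proj i x = x i"

definition box_topology :: "'i set \<Rightarrow> ('i \<Rightarrow> 'a topology) \<Rightarrow> ('i \<Rightarrow> 'a) topology" where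
  "box_topology I T = topology_generated_by {Pi\<^sub>E I U | U. \<forall>i\<in>I. openin (T i) (U i)}"

definition tau_0 ::
    "'i set \<Rightarrow> ('i \<Rightarrow> ('k::real_normed_field, 'a) module) \<Rightarrow> ('i \<Rightarrow> 'a topology) \<Rightarrow>
     ('i \<Rightarrow> 'a) topology" where
  "tau_0 I E T = subtopology (product_topology T I) (carrier (direct_sum I E))"

definition tau_b ::
    "'i set \<Rightarrow> ('i \<Rightarrow> ('k::real_normed_field, 'a) module) \<Rightarrow> ('i \<Rightarrow> 'a topology) \<Rightarrow>
     ('i \<Rightarrow> 'a) topology" where
  "tau_b I E T = subtopology (box_topology I T) (carrier (direct_sum I E))"

definition is_finest_topology :: "('a topology \<Rightarrow> bool) \<Rightarrow> 'a topology \<Rightarrow> bool" where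
  "is_finest_topology P T \<longleftrightarrow>
     P T \<and> (\<forall>T'. P T' \<longrightarrow> (\<forall>U. openin T' U \<longrightarrow> openin T U))"

text \<open>
  A finest topology with a given property is unique if it exists. The following predicates
  say that a topology is the direct sum topology, respectively the locally convex direct sum
  topology; they include the existence of these topologies.
\<close>

definition is_tau_l ::
    "'i set \<Rightarrow> ('i \<Rightarrow> ('k::real_normed_field, 'a) module) \<Rightarrow> ('i \<Rightarrow> 'a topology) \<Rightarrow>
     ('i \<Rightarrow> 'a) topology \<Rightarrow> bool" where
  "is_tau_l I E T =
     is_finest_topology (\<lambda>S. linear_topology (direct_sum I E) S \<and>
       (\<forall>i\<in>I. continuous_map (T i) S (dsum_inclusion I E i)))"

definition is_tau_lc ::
    "'i set \<Rightarrow> ('i \<Rightarrow> ('k::real_normed_field, 'a) module) \<Rightarrow> ('i \<Rightarrow> 'a topology) \<Rightarrow>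
     ('i \<Rightarrow> 'a) topology \<Rightarrow> bool" where
  "is_tau_lc I E T =
     is_finest_topology (\<lambda>S. locally_convex_topology (direct_sum I E) S \<and>
       (\<forall>i\<in>I. continuous_map (T i) S (dsum_inclusion I E i)))"

definition nu_hat :: "('i \<Rightarrow> 'l \<Rightarrow> 'a \<Rightarrow> real) \<Rightarrow> 'i \<Rightarrow> 'l \<Rightarrow> ('i \<Rightarrow> 'a) \<Rightarrow> real" where
  "nu_hat \<nu> i l = \<nu> i l \<circ> proj i"

definition mu_hat ::
    "'i set \<Rightarrow> ('i \<Rightarrow> 'l \<Rightarrow> 'a \<Rightarrow> real) \<Rightarrow> ('i \<Rightarrow> 'l) \<Rightarrow> ('i \<Rightarrow> 'a) \<Rightarrow> real" where
  "mu_hat I \<nu> \<rho> = (\<lambda>x. \<Sum>k\<in>I. nu_hat \<nu> k (\<rho> k) x)"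

end

theory Submission
  imports Defs
begin

text \<open>
  A ball of the sum seminorm of radius \<open>\<epsilon>\<close> lies between boxes: it contains a box of balls of radius
  \<open>\<epsilon> / (n + 1)\<close> and is contained in the box of balls of radius \<open>\<epsilon>\<close>. Hence the sum seminorms
  generate the product topology, which for finitely many factors is the box topology.
  The identity map is the finite sum of the composites inclusion after projection, so it is
  continuous from the product topology into any linear topology making the inclusions continuous;
  this makes the product topology the finest one in both the linear and the locally convex sense.
  Uniqueness holds because translations are homeomorphisms, so a linear topology is determined by
  its neighbourhoods of zero.
\<close>

section \<open>Vector spaces\<close>

context
  fixes V :: "('k::real_normed_field, 'v) module"
  assumes V: "vspace V"
begin

interpretation Module.module "ring_of_type_algebra :: 'k ring" V
  using V by (simp add: vspace_def)

lemma vspace_abelian_group: "abelian_group V"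
  by (rule M.abelian_group_axioms)

text \<open>The library states the module laws over the record \<open>ring_of_type_algebra\<close>.
  This lemma and the next ones restate them with the type class operations on the scalars, so that
  arithmetic on scalars becomes available to the simplifier.\<close>

lemma vspace_smult_closed: "x \<in> carrier V \<Longrightarrow> a \<odot>\<^bsub>V\<^esub> x \<in> carrier V"
  using smult_closed[of a x] by (simp add: ring_of_type_algebra_def)

lemma vspace_smult_add_left:
  "x \<in> carrier V \<Longrightarrow> (a + b) \<odot>\<^bsub>V\<^esub> x = a \<odot>\<^bsub>V\<^esub> x \<oplus>\<^bsub>V\<^esub> b \<odot>\<^bsub>V\<^esub> x"
  using smult_l_distr[of a b x] by (simp add: ring_of_type_algebra_def)

lemma vspace_smult_add_right:
  "x \<in> carrier V \<Longrightarrow> y \<in> carrier V \<Longrightarrow>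
    a \<odot>\<^bsub>V\<^esub> (x \<oplus>\<^bsub>V\<^esub> y) = a \<odot>\<^bsub>V\<^esub> x \<oplus>\<^bsub>V\<^esub> a \<odot>\<^bsub>V\<^esub> y"
  using smult_r_distr[of a x y] by (simp add: ring_of_type_algebra_def)

lemma vspace_smult_smult:
  "x \<in> carrier V \<Longrightarrow> (a * b) \<odot>\<^bsub>V\<^esub> x = a \<odot>\<^bsub>V\<^esub> (b \<odot>\<^bsub>V\<^esub> x)"
  using smult_assoc1[of a b x] by (simp add: ring_of_type_algebra_def)

lemma vspace_smult_one: "x \<in> carrier V \<Longrightarrow> 1 \<odot>\<^bsub>V\<^esub> x = x"
  using smult_one[of x] by (simp add: ring_of_type_algebra_def)

lemma vspace_smult_zero: "x \<in> carrier V \<Longrightarrow> 0 \<odot>\<^bsub>V\<^esub> x = \<zero>\<^bsub>V\<^esub>"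
  using smult_l_null[of x] by (simp add: ring_of_type_algebra_def)

text \<open>The record of a direct sum defines addition and scalar multiplication componentwise but
  has no field for inverses. Writing the inverse as a scalar multiple makes subtraction computable
  componentwise as well.\<close>

lemma vspace_uminus:
  assumes x: "x \<in> carrier V"
  shows "\<ominus>\<^bsub>V\<^esub> x = (- 1) \<odot>\<^bsub>V\<^esub> x"
proof -
  have "x \<oplus>\<^bsub>V\<^esub> (- 1) \<odot>\<^bsub>V\<^esub> x = (1 + - 1) \<odot>\<^bsub>V\<^esub> x"
    using x vspace_smult_add_left[of x 1 "- 1"] by (simp only: vspace_smult_one)
  also have "\<dots> = \<zero>\<^bsub>V\<^esub>"
    using x by (simp add: vspace_smult_zero)
  finally show ?thesis
    using x vspace_smult_closed[OF x] M.minus_equality M.a_comm by metis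
qed

lemma vspace_minus:
  "x \<in> carrier V \<Longrightarrow> y \<ominus>\<^bsub>V\<^esub> x = y \<oplus>\<^bsub>V\<^esub> (- 1) \<odot>\<^bsub>V\<^esub> x"
  by (simp add: a_minus_def vspace_uminus)

section \<open>Seminorms and their balls\<close>

lemma seminorm_on_nonneg: "seminorm_on V p \<Longrightarrow> x \<in> carrier V \<Longrightarrow> 0 \<le> p x"
  by (simp add: seminorm_on_def)

lemma seminorm_on_add:
  "seminorm_on V p \<Longrightarrow> x \<in> carrier V \<Longrightarrow> y \<in> carrier V \<Longrightarrow> p (x \<oplus>\<^bsub>V\<^esub> y) \<le> p x + p y"
  by (simp add: seminorm_on_def)

lemma seminorm_on_smult:
  "seminorm_on V p \<Longrightarrow> x \<in> carrier V \<Longrightarrow> p (a \<odot>\<^bsub>V\<^esub> x) = norm a * p x"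
  by (simp add: seminorm_on_def)

lemma seminorm_on_zero: "seminorm_on V p \<Longrightarrow> p \<zero>\<^bsub>V\<^esub> = 0"
  using seminorm_on_smult[of p "\<zero>\<^bsub>V\<^esub>" 0] vspace_smult_zero[of "\<zero>\<^bsub>V\<^esub>"] by simp

lemma seminorm_on_diff_triangle:
  assumes p: "seminorm_on V p" and xyz: "x \<in> carrier V" "y \<in> carrier V" "z \<in> carrier V"
  shows "p (x \<ominus>\<^bsub>V\<^esub> z) \<le> p (x \<ominus>\<^bsub>V\<^esub> y) + p (y \<ominus>\<^bsub>V\<^esub> z)"
proof -
  have "x \<ominus>\<^bsub>V\<^esub> z = (x \<ominus>\<^bsub>V\<^esub> y) \<oplus>\<^bsub>V\<^esub> (y \<ominus>\<^bsub>V\<^esub> z)"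
    using xyz by (simp add: a_minus_def M.a_assoc M.r_neg1)
  then show ?thesis
    using seminorm_on_add[OF p, of "x \<ominus>\<^bsub>V\<^esub> y" "y \<ominus>\<^bsub>V\<^esub> z"] xyz by simp
qed

lemma seminorm_ball_center:
  "seminorm_on V p \<Longrightarrow> x \<in> carrier V \<Longrightarrow> 0 < \<epsilon> \<Longrightarrow> x \<in> seminorm_ball V p x \<epsilon>"
  by (simp add: seminorm_ball_def a_minus_def M.r_neg seminorm_on_zero)

lemma seminorm_ball_zero: "seminorm_ball V p \<zero>\<^bsub>V\<^esub> \<epsilon> = {x \<in> carrier V. p x < \<epsilon>}"
  using M.add.inv_one by (auto simp: seminorm_ball_def a_minus_def a_inv_def)

text \<open>The weights are nonnegative reals, so their images among the scalars have norm
  \<open>1 - t\<close> and \<open>t\<close>. A convex combination of two numbers below \<epsilon> is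
  again below \<epsilon>, with strict inequality also at \<open>t = 0\<close> and
  \<open>t = 1\<close>.\<close>

lemma convex_in_seminorm_ball_zero:
  assumes p: "seminorm_on V p"
  shows "convex_in V (seminorm_ball V p \<zero>\<^bsub>V\<^esub> \<epsilon>)"
  unfolding seminorm_ball_zero convex_in_def
proof (intro conjI ballI allI impI; (elim conjE)?)
  fix x y and t :: real
  assume x: "x \<in> {x \<in> carrier V. p x < \<epsilon>}" and y: "y \<in> {x \<in> carrier V. p x < \<epsilon>}"
    and t: "0 \<le> t" "t \<le> 1"
  let ?z = "of_real (1 - t) \<odot>\<^bsub>V\<^esub> x \<oplus>\<^bsub>V\<^esub> of_real t \<odot>\<^bsub>V\<^esub> y"
  have "p ?z \<le> norm (of_real (1 - t) :: 'k) * p x + norm (of_real t :: 'k) * p y"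
    using seminorm_on_add[OF p, of "of_real (1 - t) \<odot>\<^bsub>V\<^esub> x" "of_real t \<odot>\<^bsub>V\<^esub> y"] x y
    by (simp add: vspace_smult_closed seminorm_on_smult[OF p])
  also have "\<dots> = (1 - t) * p x + t * p y"
    using t by (simp only: norm_of_real abs_of_nonneg diff_ge_0_iff_ge)
  also have "\<dots> < \<epsilon>"
    using convex_bound_lt[of "p x" \<epsilon> "p y" "1 - t" t] x y t by simp
  finally show "?z \<in> {x \<in> carrier V. p x < \<epsilon>}"
    using x y by (simp add: vspace_smult_closed)
qed auto

section \<open>Topologies defined by directed sets of seminorms\<close>

text \<open>The balls are introduced only as a subbase. Directedness turns them into a base, and the
  triangle inequality lets each point of a ball serve as the centre of a smaller one. The forward
  direction is an induction over the generation of open sets.\<close>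

lemma openin_seminorm_topology:
  assumes S: "directed_seminorms V S"
  shows "openin (seminorm_topology V S) U \<longleftrightarrow>
    U \<subseteq> carrier V \<and> (\<forall>x\<in>U. \<exists>p\<in>S. \<exists>\<epsilon>>0. seminorm_ball V p x \<epsilon> \<subseteq> U)"
proof
  let ?B = "insert (carrier V)
    {seminorm_ball V p x \<epsilon> | p x \<epsilon>. p \<in> S \<and> x \<in> carrier V \<and> 0 < \<epsilon>}"
  have S1: "S \<noteq> {}" "\<And>p. p \<in> S \<Longrightarrow> seminorm_on V p"
    using S by (auto simp: directed_seminorms_def)
  assume "openin (seminorm_topology V S) U"
  then have "generate_topology_on ?B U"
    by (simp add: seminorm_topology_def openin_topology_generated_by_iff)
  then show "U \<subseteq> carrier V \<and> (\<forall>x\<in>U. \<exists>p\<in>S. \<exists>\<epsilon>>0. seminorm_ball V p x \<epsilon> \<subseteq> U)"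
  proof induction
    case Empty
    then show ?case by simp
  next
    case (Int a b)
    have "\<exists>r\<in>S. \<exists>\<epsilon>>0. seminorm_ball V r x \<epsilon> \<subseteq> a \<inter> b" if x: "x \<in> a \<inter> b" for x
    proof -
      obtain p \<epsilon> where p: "p \<in> S" "\<epsilon> > 0" "seminorm_ball V p x \<epsilon> \<subseteq> a"
        using Int x by blast
      obtain q \<delta> where q: "q \<in> S" "\<delta> > 0" "seminorm_ball V q x \<delta> \<subseteq> b"
        using Int x by blast
      obtain r where r: "r \<in> S" "\<And>x. x \<in> carrier V \<Longrightarrow> p x \<le> r x \<and> q x \<le> r x"
        using S p(1) q(1) unfolding directed_seminorms_def by blast
      have xV: "x \<in> carrier V" using x Int by auto
      \<comment> \<open>Since \<open>r\<close> dominates both \<open>p\<close> and \<open>q\<close>,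
        one ball of \<open>r\<close> fits into both given balls; this is where directedness
        enters.\<close>
      have "seminorm_ball V r x (min \<epsilon> \<delta>) \<subseteq> seminorm_ball V p x \<epsilon> \<inter> seminorm_ball V q x \<delta>"
      proof
        fix y assume "y \<in> seminorm_ball V r x (min \<epsilon> \<delta>)"
        then have y: "y \<in> carrier V" "r (y \<ominus>\<^bsub>V\<^esub> x) < min \<epsilon> \<delta>"
          by (auto simp: seminorm_ball_def)
        with r(2)[of "y \<ominus>\<^bsub>V\<^esub> x"] xV
        show "y \<in> seminorm_ball V p x \<epsilon> \<inter> seminorm_ball V q x \<delta>"
          by (auto simp: seminorm_ball_def)
      qed
      then show ?thesis
        using p q r(1) by (intro bexI[of _ r] exI[of _ "min \<epsilon> \<delta>"]) auto
    qed
    then show ?case using Int by blast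
  next
    case (UN K)
    then show ?case
      by (meson Union_iff Union_upper Union_least subset_trans)
  next
    case (Basis s)
    then consider "s = carrier V"
      | p z \<epsilon> where "s = seminorm_ball V p z \<epsilon>" "p \<in> S" "z \<in> carrier V" "0 < \<epsilon>"
      by blast
    then show ?case
    proof cases
      case 1
      \<comment> \<open>The whole space contains every ball, so any member of the nonempty set
        \<open>S\<close> will do, with radius 1.\<close>
      then show ?thesis
        using S1(1) by (auto simp: seminorm_ball_def intro!: exI[of _ "1::real"])
    next
      case 2
      have "\<exists>q\<in>S. \<exists>\<delta>>0. seminorm_ball V q x \<delta> \<subseteq> s" if x: "x \<in> s" for x
      proof (intro bexI exI conjI)
        \<comment> \<open>The radius left over after moving the centre from \<open>z\<close> to
          \<open>x\<close>.\<close>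
        let ?d = "\<epsilon> - p (x \<ominus>\<^bsub>V\<^esub> z)"
        show "0 < ?d" using x 2 by (simp add: seminorm_ball_def)
        show "seminorm_ball V p x ?d \<subseteq> s"
        proof
          fix y assume "y \<in> seminorm_ball V p x ?d"
          then have y: "y \<in> carrier V" "p (y \<ominus>\<^bsub>V\<^esub> x) < ?d"
            by (auto simp: seminorm_ball_def)
          have "x \<in> carrier V" using x 2 by (simp add: seminorm_ball_def)
          with seminorm_on_diff_triangle[OF S1(2)[OF 2(2)], of y x z] y 2
          show "y \<in> s" by (simp add: seminorm_ball_def)
        qed
      qed (rule 2)
      then show ?thesis using 2(1) by (auto simp: seminorm_ball_def)
    qed
  qed
next
  assume U: "U \<subseteq> carrier V \<and> (\<forall>x\<in>U. \<exists>p\<in>S. \<exists>\<epsilon>>0. seminorm_ball V p x \<epsilon> \<subseteq> U)"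
  show "openin (seminorm_topology V S) U"
  proof (subst openin_subopen, intro ballI)
    fix x assume x: "x \<in> U"
    then obtain p \<epsilon> where p: "p \<in> S" "\<epsilon> > 0" "seminorm_ball V p x \<epsilon> \<subseteq> U"
      using U by blast
    have "openin (seminorm_topology V S) (seminorm_ball V p x \<epsilon>)"
      unfolding seminorm_topology_def
      by (rule topology_generated_by_Basis) (use U x p in blast)
    moreover have "x \<in> seminorm_ball V p x \<epsilon>"
      using S p U x by (intro seminorm_ball_center) (auto simp: directed_seminorms_def)
    ultimately show "\<exists>W. openin (seminorm_topology V S) W \<and> x \<in> W \<and> W \<subseteq> U"
      using p by blast
  qed
qed

lemma openin_seminorm_ball:
  "p \<in> S \<Longrightarrow> x \<in> carrier V \<Longrightarrow> 0 < \<epsilon> \<Longrightarrow>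
    openin (seminorm_topology V S) (seminorm_ball V p x \<epsilon>)"
  unfolding seminorm_topology_def by (rule topology_generated_by_Basis) blast

lemma topspace_seminorm_topology: "topspace (seminorm_topology V S) = carrier V"
  by (auto simp: seminorm_topology_def seminorm_ball_def)

text \<open>Both continuity claims are checked at a point by exhibiting a product of balls inside
  the preimage. For addition, half the radius in each argument suffices.\<close>

lemma linear_topology_seminorm_topology:
  assumes S: "directed_seminorms V S"
  shows "linear_topology V (seminorm_topology V S)"
proof -
  let ?T = "seminorm_topology V S"
  have S1: "\<And>p. p \<in> S \<Longrightarrow> seminorm_on V p"
    using S by (auto simp: directed_seminorms_def)
  have "continuous_map (prod_topology ?T ?T) ?T (\<lambda>(x, y). x \<oplus>\<^bsub>V\<^esub> y)"
    unfolding continuous_map_def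
  proof (intro conjI allI impI)
    show "(\<lambda>(x, y). x \<oplus>\<^bsub>V\<^esub> y) \<in> topspace (prod_topology ?T ?T) \<rightarrow> topspace ?T"
      by (auto simp: topspace_seminorm_topology)
    fix U assume U: "openin ?T U"
    show "openin (prod_topology ?T ?T)
      {z \<in> topspace (prod_topology ?T ?T). (case z of (x, y) \<Rightarrow> x \<oplus>\<^bsub>V\<^esub> y) \<in> U}"
      (is "openin _ ?P")
      unfolding openin_prod_topology_alt
    proof (intro allI impI)
      fix x y assume "(x, y) \<in> ?P"
      then have xy: "x \<in> carrier V" "y \<in> carrier V" "x \<oplus>\<^bsub>V\<^esub> y \<in> U"
        by (auto simp: topspace_seminorm_topology)
      obtain p \<epsilon> where p: "p \<in> S" "\<epsilon> > 0" "seminorm_ball V p (x \<oplus>\<^bsub>V\<^esub> y) \<epsilon> \<subseteq> U"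
        using U xy(3) by (auto simp: openin_seminorm_topology[OF S])
      have "(u, v) \<in> ?P"
        if "u \<in> seminorm_ball V p x (\<epsilon>/2)" "v \<in> seminorm_ball V p y (\<epsilon>/2)" for u v
      proof -
        have uv: "u \<in> carrier V" "p (u \<ominus>\<^bsub>V\<^esub> x) < \<epsilon>/2" "v \<in> carrier V" "p (v \<ominus>\<^bsub>V\<^esub> y) < \<epsilon>/2"
          using that by (auto simp: seminorm_ball_def)
        have "(u \<oplus>\<^bsub>V\<^esub> v) \<ominus>\<^bsub>V\<^esub> (x \<oplus>\<^bsub>V\<^esub> y) = (u \<ominus>\<^bsub>V\<^esub> x) \<oplus>\<^bsub>V\<^esub> (v \<ominus>\<^bsub>V\<^esub> y)"
          using uv xy by (simp add: a_minus_def M.minus_add M.a_ac)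
        then have "p ((u \<oplus>\<^bsub>V\<^esub> v) \<ominus>\<^bsub>V\<^esub> (x \<oplus>\<^bsub>V\<^esub> y)) < \<epsilon>"
          using seminorm_on_add[OF S1[OF p(1)], of "u \<ominus>\<^bsub>V\<^esub> x" "v \<ominus>\<^bsub>V\<^esub> y"] uv xy by simp
        then have "u \<oplus>\<^bsub>V\<^esub> v \<in> U"
          using p uv by (auto simp: seminorm_ball_def)
        then show ?thesis
          using uv by (simp add: topspace_seminorm_topology)
      qed
      then have "seminorm_ball V p x (\<epsilon>/2) \<times> seminorm_ball V p y (\<epsilon>/2) \<subseteq> ?P"
        by blast
      then show "\<exists>A B. openin ?T A \<and> openin ?T B \<and> x \<in> A \<and> y \<in> B \<and> A \<times> B \<subseteq> ?P"
        using p xy S1 by (meson half_gt_zero openin_seminorm_ball seminorm_ball_center)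
    qed
  qed
  moreover have "continuous_map (prod_topology (euclidean :: 'k topology) ?T) ?T
      (\<lambda>(a, x). a \<odot>\<^bsub>V\<^esub> x)"
    unfolding continuous_map_def
  proof (intro conjI allI impI)
    let ?D = "prod_topology (euclidean :: 'k topology) ?T"
    show "(\<lambda>(a, x). a \<odot>\<^bsub>V\<^esub> x) \<in> topspace ?D \<rightarrow> topspace ?T"
      by (auto simp: topspace_seminorm_topology vspace_smult_closed)
    fix U assume U: "openin ?T U"
    show "openin ?D {z \<in> topspace ?D. (case z of (a, x) \<Rightarrow> a \<odot>\<^bsub>V\<^esub> x) \<in> U}"
      (is "openin _ ?P")
      unfolding openin_prod_topology_alt
    proof (intro allI impI)
      fix a x assume "(a, x) \<in> ?P"
      then have ax: "x \<in> carrier V" "a \<odot>\<^bsub>V\<^esub> x \<in> U"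
        by (auto simp: topspace_seminorm_topology)
      obtain p \<epsilon> where p: "p \<in> S" "\<epsilon> > 0" "seminorm_ball V p (a \<odot>\<^bsub>V\<^esub> x) \<epsilon> \<subseteq> U"
        using U ax by (auto simp: openin_seminorm_topology[OF S])
      have px: "p x \<ge> 0" using S1 p ax seminorm_on_nonneg by blast
      \<comment> \<open>The difference of \<open>b y\<close> and \<open>a x\<close> is split as
        \<open>b (y - x) + (b - a) x\<close>. As \<delta> is at most 1, the norm of \<open>b\<close>
        is at most \<open>norm a + 1\<close>, so the seminorm of the difference is below
        \<open>\<delta> * M\<close>, hence below \<epsilon>. The summand 1 also keeps
        \<open>M\<close> positive.\<close>
      define M where "M = norm a + 1 + p x"
      define \<delta> where "\<delta> = min 1 (\<epsilon> / M)"
      have M: "M > 0" using px by (simp add: M_def add_nonneg_pos add_pos_nonneg)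
      have \<delta>: "0 < \<delta>" "\<delta> \<le> 1" "\<delta> * M \<le> \<epsilon>"
        using p M by (auto simp: \<delta>_def min_def field_simps)
      have "(b, y) \<in> ?P" if b: "b \<in> ball a \<delta>" and "y \<in> seminorm_ball V p x \<delta>" for b y
      proof -
        have y: "y \<in> carrier V" "p (y \<ominus>\<^bsub>V\<^esub> x) < \<delta>"
          using that by (auto simp: seminorm_ball_def)
        have ba: "norm (b - a) < \<delta>" using b by (simp add: dist_norm norm_minus_commute)
        have nb: "norm b \<le> norm a + 1"
          using norm_triangle_ineq[of a "b - a"] ba \<delta> by simp
        have "b \<odot>\<^bsub>V\<^esub> y \<ominus>\<^bsub>V\<^esub> a \<odot>\<^bsub>V\<^esub> x = b \<odot>\<^bsub>V\<^esub> (y \<ominus>\<^bsub>V\<^esub> x) \<oplus>\<^bsub>V\<^esub> (b - a) \<odot>\<^bsub>V\<^esub> x"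
        proof -
          have "(b - a) \<odot>\<^bsub>V\<^esub> x = b \<odot>\<^bsub>V\<^esub> x \<oplus>\<^bsub>V\<^esub> (- a) \<odot>\<^bsub>V\<^esub> x"
            using vspace_smult_add_left[of x b "- a"] ax by simp
          moreover have "b \<odot>\<^bsub>V\<^esub> (y \<ominus>\<^bsub>V\<^esub> x) = b \<odot>\<^bsub>V\<^esub> y \<oplus>\<^bsub>V\<^esub> (- b) \<odot>\<^bsub>V\<^esub> x"
            using ax y vspace_smult_smult[of x b "- 1"]
            by (simp add: vspace_minus vspace_smult_add_right vspace_smult_closed)
          moreover have "(- b) \<odot>\<^bsub>V\<^esub> x \<oplus>\<^bsub>V\<^esub> (b \<odot>\<^bsub>V\<^esub> x \<oplus>\<^bsub>V\<^esub> (- a) \<odot>\<^bsub>V\<^esub> x) = (- a) \<odot>\<^bsub>V\<^esub> x"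
            using ax vspace_smult_add_left[of x "- b" b]
            by (simp add: vspace_smult_closed vspace_smult_zero flip: M.a_assoc)
          moreover have "b \<odot>\<^bsub>V\<^esub> y \<ominus>\<^bsub>V\<^esub> a \<odot>\<^bsub>V\<^esub> x = b \<odot>\<^bsub>V\<^esub> y \<oplus>\<^bsub>V\<^esub> (- a) \<odot>\<^bsub>V\<^esub> x"
            using ax vspace_smult_smult[of x "- 1" a] by (simp add: vspace_minus vspace_smult_closed)
          ultimately show ?thesis
            using ax y by (simp add: vspace_smult_closed M.a_assoc)
        qed
        then have "p (b \<odot>\<^bsub>V\<^esub> y \<ominus>\<^bsub>V\<^esub> a \<odot>\<^bsub>V\<^esub> x) \<le> norm b * p (y \<ominus>\<^bsub>V\<^esub> x) + norm (b - a) * p x"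
          using seminorm_on_add[OF S1[OF p(1)], of "b \<odot>\<^bsub>V\<^esub> (y \<ominus>\<^bsub>V\<^esub> x)" "(b - a) \<odot>\<^bsub>V\<^esub> x"] ax y
          by (simp add: vspace_smult_closed seminorm_on_smult[OF S1[OF p(1)]])
        also have "\<dots> \<le> (norm a + 1) * p (y \<ominus>\<^bsub>V\<^esub> x) + \<delta> * p x"
          using nb ba px seminorm_on_nonneg[OF S1[OF p(1)], of "y \<ominus>\<^bsub>V\<^esub> x"] ax y
          by (intro add_mono mult_right_mono) auto
        \<comment> \<open>Strictness comes from this term, because the factor
          \<open>norm a + 1\<close> is positive even for \<open>a = 0\<close>.\<close>
        also have "\<dots> < (norm a + 1) * \<delta> + \<delta> * p x"
          using y by (simp add: add_nonneg_pos)
        also have "\<dots> \<le> \<epsilon>"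
          using \<delta> by (simp add: M_def algebra_simps)
        finally have "b \<odot>\<^bsub>V\<^esub> y \<in> U"
          using p y by (auto simp: seminorm_ball_def vspace_smult_closed)
        then show ?thesis
          using y by (simp add: topspace_seminorm_topology)
      qed
      then have "ball a \<delta> \<times> seminorm_ball V p x \<delta> \<subseteq> ?P"
        by blast
      moreover have "openin euclidean (ball a \<delta>)" "a \<in> ball a \<delta>"
        using \<delta> by auto
      ultimately show "\<exists>A B. openin euclidean A \<and> openin ?T B \<and> a \<in> A \<and> x \<in> B \<and> A \<times> B \<subseteq> ?P"
        using p ax S1 \<delta>(1) by (meson openin_seminorm_ball seminorm_ball_center)
    qed
  qed
  ultimately show ?thesis
    by (simp add: linear_topology_def V topspace_seminorm_topology)
qed

section \<open>Local convexity and the base at zero\<close>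

lemma locally_convex_seminorm_topology:
  assumes S: "directed_seminorms V S"
  shows "locally_convex_topology V (seminorm_topology V S)"
  unfolding locally_convex_topology_def neighbourhood_base_at_def
proof (intro conjI allI impI; (elim conjE)?)
  fix W assume W: "openin (seminorm_topology V S) W" "\<zero>\<^bsub>V\<^esub> \<in> W"
  then obtain p \<epsilon> where p: "p \<in> S" "\<epsilon> > 0" "seminorm_ball V p \<zero>\<^bsub>V\<^esub> \<epsilon> \<subseteq> W"
    using S by (auto simp: openin_seminorm_topology)
  moreover have "seminorm_on V p" using S p by (auto simp: directed_seminorms_def)
  ultimately show "\<exists>U C. openin (seminorm_topology V S) U \<and> convex_in V C \<and>
      \<zero>\<^bsub>V\<^esub> \<in> U \<and> U \<subseteq> C \<and> C \<subseteq> W"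
    \<comment> \<open>One ball serves both as the open neighbourhood and as the convex set.\<close>
    by (intro exI[of _ "seminorm_ball V p \<zero>\<^bsub>V\<^esub> \<epsilon>"])
       (simp add: openin_seminorm_ball convex_in_seminorm_ball_zero seminorm_ball_center)
qed (rule linear_topology_seminorm_topology[OF S])

text \<open>One direction shrinks an open neighbourhood of zero to a ball; the other uses that balls
  around zero are themselves open neighbourhoods of it.\<close>

lemma filter_base_seminorm_topology:
  assumes S: "directed_seminorms V S"
  shows "filter_base (nhdsin (seminorm_topology V S) \<zero>\<^bsub>V\<^esub>)
    {{x \<in> carrier V. p x < \<epsilon>} | p \<epsilon>. 0 < \<epsilon> \<and> p \<in> S}"
  unfolding filter_base_def eventually_nhdsin topspace_seminorm_topology
proof (intro allI iffI)
  fix P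
  \<comment> \<open>The first disjunct comes from \<open>eventually_nhdsin\<close>, which makes the
    filter trivial at points outside the space; zero lies in the carrier, so it is false.\<close>
  assume "\<zero>\<^bsub>V\<^esub> \<notin> carrier V \<or>
    (\<exists>U. openin (seminorm_topology V S) U \<and> \<zero>\<^bsub>V\<^esub> \<in> U \<and> (\<forall>x\<in>U. P x))"
  then obtain U where U: "openin (seminorm_topology V S) U" "\<zero>\<^bsub>V\<^esub> \<in> U" "\<forall>x\<in>U. P x"
    by auto
  then obtain p \<epsilon> where p: "p \<in> S" "\<epsilon> > 0" "seminorm_ball V p \<zero>\<^bsub>V\<^esub> \<epsilon> \<subseteq> U"
    using S by (auto simp: openin_seminorm_topology)
  then show "\<exists>B\<in>{{x \<in> carrier V. p x < \<epsilon>} | p \<epsilon>. 0 < \<epsilon> \<and> p \<in> S}. \<forall>x\<in>B. P x"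
    using U(3) unfolding seminorm_ball_zero by blast
next
  fix P
  assume "\<exists>B\<in>{{x \<in> carrier V. p x < \<epsilon>} | p \<epsilon>. 0 < \<epsilon> \<and> p \<in> S}. \<forall>x\<in>B. P x"
  then obtain p \<epsilon> where p: "p \<in> S" "\<epsilon> > 0" "\<forall>x\<in>seminorm_ball V p \<zero>\<^bsub>V\<^esub> \<epsilon>. P x"
    unfolding seminorm_ball_zero by blast
  moreover have "seminorm_on V p" using S p by (auto simp: directed_seminorms_def)
  ultimately show "\<zero>\<^bsub>V\<^esub> \<notin> carrier V \<or>
      (\<exists>U. openin (seminorm_topology V S) U \<and> \<zero>\<^bsub>V\<^esub> \<in> U \<and> (\<forall>x\<in>U. P x))"
    by (meson M.zero_closed openin_seminorm_ball seminorm_ball_center)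
qed

section \<open>Linear topologies are determined by the neighbourhoods of zero\<close>

text \<open>Pairing the two maps and composing with addition. It yields the continuity of
  translations and, later, of finite sums of inclusions.\<close>

lemma continuous_map_linear_add:
  assumes T: "linear_topology V T"
    and f: "continuous_map Y T f" and g: "continuous_map Y T g"
  shows "continuous_map Y T (\<lambda>x. f x \<oplus>\<^bsub>V\<^esub> g x)"
proof -
  have "continuous_map Y (prod_topology T T) (\<lambda>x. (f x, g x))"
    using f g by (simp add: continuous_map_pairedI)
  then have "continuous_map Y T ((\<lambda>(x, y). x \<oplus>\<^bsub>V\<^esub> y) \<circ> (\<lambda>x. (f x, g x)))"
    using T by (auto simp: linear_topology_def intro: continuous_map_compose)
  then show ?thesis by (simp add: o_def)
qed

text \<open>Translation by \<open>x\<close> is continuous and takes zero to \<open>x\<close>, and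
  translation by the inverse takes \<open>x\<close> back to zero. The resulting criterion for
  openness refers to the topology only through its neighbourhood filter at zero.\<close>

lemma openin_linear_topology:
  assumes T: "linear_topology V T"
  shows "openin T U \<longleftrightarrow>
    U \<subseteq> carrier V \<and> (\<forall>x\<in>U. eventually (\<lambda>v. v \<oplus>\<^bsub>V\<^esub> x \<in> U) (nhdsin T \<zero>\<^bsub>V\<^esub>))"
proof -
  have top: "topspace T = carrier V" using T by (simp add: linear_topology_def)
  have trans: "continuous_map T T (\<lambda>v. v \<oplus>\<^bsub>V\<^esub> x)" if "x \<in> carrier V" for x
    using that continuous_map_linear_add[OF T, of T "\<lambda>v. v" "\<lambda>v. x"] by (simp add: top)
  show ?thesis
  proof (intro iffI conjI ballI)
    assume U: "openin T U"
    then show UV: "U \<subseteq> carrier V" using openin_subset top by blast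
    fix x assume x: "x \<in> U"
    then have "openin T {v \<in> topspace T. v \<oplus>\<^bsub>V\<^esub> x \<in> U}"
      using trans UV U openin_continuous_map_preimage by blast
    moreover have "\<zero>\<^bsub>V\<^esub> \<in> {v \<in> topspace T. v \<oplus>\<^bsub>V\<^esub> x \<in> U}"
      using x UV by (auto simp: top)
    ultimately show "eventually (\<lambda>v. v \<oplus>\<^bsub>V\<^esub> x \<in> U) (nhdsin T \<zero>\<^bsub>V\<^esub>)"
      unfolding eventually_nhdsin by blast
  next
    assume U: "U \<subseteq> carrier V \<and> (\<forall>x\<in>U. eventually (\<lambda>v. v \<oplus>\<^bsub>V\<^esub> x \<in> U) (nhdsin T \<zero>\<^bsub>V\<^esub>))"
    show "openin T U"
    proof (subst openin_subopen, intro ballI)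
      fix x assume x: "x \<in> U"
      then have xV: "x \<in> carrier V" using U by blast
      obtain N where N: "openin T N" "\<zero>\<^bsub>V\<^esub> \<in> N" "\<forall>v\<in>N. v \<oplus>\<^bsub>V\<^esub> x \<in> U"
        using U x by (auto simp: eventually_nhdsin top)
      \<comment> \<open>The translate of \<open>N\<close> to \<open>x\<close>, written as a preimage
        so that it is open by continuity. Adding \<open>x\<close> back to a member of
        \<open>N\<close> lands in \<open>U\<close>.\<close>
      let ?W = "{y \<in> topspace T. y \<oplus>\<^bsub>V\<^esub> (\<ominus>\<^bsub>V\<^esub> x) \<in> N}"
      have "openin T ?W"
        using trans N(1) xV openin_continuous_map_preimage by blast
      moreover have "x \<in> ?W"
        using N xV by (simp add: top M.r_neg)
      moreover have "?W \<subseteq> U"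
      proof clarify
        fix y assume y: "y \<in> topspace T" "y \<oplus>\<^bsub>V\<^esub> (\<ominus>\<^bsub>V\<^esub> x) \<in> N"
        then have "(y \<oplus>\<^bsub>V\<^esub> (\<ominus>\<^bsub>V\<^esub> x)) \<oplus>\<^bsub>V\<^esub> x \<in> U" using N by blast
        then show "y \<in> U" using y xV by (simp add: top M.a_assoc M.l_neg)
      qed
      ultimately show "\<exists>W. openin T W \<and> x \<in> W \<and> W \<subseteq> U" by blast
    qed
  qed
qed

text \<open>A base in the sense of \<open>filter_base\<close> fixes which predicates hold eventually
  at zero, and the criterion \<open>openin_linear_topology\<close> involves nothing else of the
  topology.\<close>

lemma linear_topology_eqI:
  assumes "linear_topology V S" "linear_topology V T"
    and "filter_base (nhdsin S \<zero>\<^bsub>V\<^esub>) \<B>" "filter_base (nhdsin T \<zero>\<^bsub>V\<^esub>) \<B>"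
  shows "S = T"
  using assms by (simp add: topology_eq openin_linear_topology filter_base_def)

end

section \<open>Finite direct sums\<close>

lemma carrier_finite_direct_sum:
  "finite I \<Longrightarrow> carrier (direct_sum I E) = (\<Pi>\<^sub>E i\<in>I. carrier (E i))"
  by (auto simp: direct_sum_def)

text \<open>With finitely many indices the finite support condition is automatic, so the direct sum
  is the whole underlying set of the product and restricting to it changes nothing.\<close>

lemma tau_0_finite:
  assumes I: "finite I" and T: "\<forall>i\<in>I. topspace (T i) = carrier (E i)"
  shows "tau_0 I E T = product_topology T I"
  unfolding tau_0_def carrier_finite_direct_sum[OF I]
  by (rule subtopology_superset) (use T in \<open>auto cong: PiE_cong\<close>)

text \<open>The two topologies even have the same generating sets: over a finite index set the
  condition that almost all factors be full can always be met.\<close>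

lemma tau_b_eq_tau_0:
  assumes I: "finite I"
  shows "tau_b I E T = tau_0 I E T"
proof -
  have "{Pi\<^sub>E I U | U. \<forall>i\<in>I. openin (T i) (U i)} =
      {Pi\<^sub>E I U | U. (\<forall>i. openin (T i) (U i)) \<and> finite {i. U i \<noteq> topspace (T i)}}"
    (is "?A = ?B")
  proof
    show "?A \<subseteq> ?B"
    proof clarify
      fix U assume U: "\<forall>i\<in>I. openin (T i) (U i)"
      \<comment> \<open>Factors outside \<open>I\<close> do not affect
        \<open>Pi\<^sub>E I U\<close>. Making them the full space is needed because the product
        topology quantifies over all indices of the type.\<close>
      let ?U = "\<lambda>i. if i \<in> I then U i else topspace (T i)"
      have "finite {i. ?U i \<noteq> topspace (T i)}"
        by (rule finite_subset[OF _ I]) auto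
      then show "\<exists>W. Pi\<^sub>E I U = Pi\<^sub>E I W \<and> (\<forall>i. openin (T i) (W i)) \<and>
          finite {i. W i \<noteq> topspace (T i)}"
        using U by (intro exI[of _ ?U]) (auto cong: PiE_cong)
    qed
  qed blast
  then show ?thesis
    by (simp add: tau_b_def tau_0_def box_topology_def product_topology_def)
qed

context
  fixes I :: "'i set" and E :: "'i \<Rightarrow> ('k::real_normed_field, 'a) module"
  assumes I: "finite I" and E: "\<forall>i\<in>I. vspace (E i)"
begin

text \<open>Every law is checked componentwise. This is enough because members of the carrier are
  extensional, so agreement on \<open>I\<close> means equality.\<close>

lemma vspace_finite_direct_sum: "vspace (direct_sum I E)"
proof -
  let ?V = "direct_sum I E"
  have ag: "abelian_group (E i)" if "i \<in> I" for i
    using that E vspace_abelian_group by blast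
  have monoid: "abelian_monoid (E i)" if "i \<in> I" for i
    using ag[OF that] by (simp add: abelian_group_def)
  note [simp] = abelian_monoid.zero_closed[OF monoid] abelian_monoid.a_closed[OF monoid]
    abelian_monoid.l_zero[OF monoid]
  have eq: "x = y" if "x \<in> carrier ?V" "y \<in> carrier ?V" "\<And>i. i \<in> I \<Longrightarrow> x i = y i" for x y
    using that unfolding carrier_finite_direct_sum[OF I] by (rule PiE_ext)
  have mem: "x i \<in> carrier (E i)" if "x \<in> carrier ?V" "i \<in> I" for x i
    using that unfolding carrier_finite_direct_sum[OF I] by auto
  have add: "(x \<oplus>\<^bsub>?V\<^esub> y) = (\<lambda>i\<in>I. x i \<oplus>\<^bsub>E i\<^esub> y i)" for x y
    by (simp add: direct_sum_def)
  have smult: "(a \<odot>\<^bsub>?V\<^esub> x) = (\<lambda>i\<in>I. a \<odot>\<^bsub>E i\<^esub> x i)" for a x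
    by (simp add: direct_sum_def)
  have zero: "\<zero>\<^bsub>?V\<^esub> = (\<lambda>i\<in>I. \<zero>\<^bsub>E i\<^esub>)"
    by (simp add: direct_sum_def)
  have add_mem: "x \<oplus>\<^bsub>?V\<^esub> y \<in> carrier ?V" if "x \<in> carrier ?V" "y \<in> carrier ?V" for x y
    using that mem by (auto simp: add carrier_finite_direct_sum[OF I])
  have smult_mem: "a \<odot>\<^bsub>?V\<^esub> x \<in> carrier ?V" if "x \<in> carrier ?V" for a x
    using that mem E by (auto simp: smult carrier_finite_direct_sum[OF I] vspace_smult_closed)
  have zero_mem: "\<zero>\<^bsub>?V\<^esub> \<in> carrier ?V"
    by (auto simp: zero carrier_finite_direct_sum[OF I])
  have "abelian_group ?V"
  proof (rule abelian_groupI)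
    fix x y z assume "x \<in> carrier ?V" "y \<in> carrier ?V" "z \<in> carrier ?V"
    then show "x \<oplus>\<^bsub>?V\<^esub> y \<oplus>\<^bsub>?V\<^esub> z = x \<oplus>\<^bsub>?V\<^esub> (y \<oplus>\<^bsub>?V\<^esub> z)"
      by (intro eq add_mem) (auto simp: add mem abelian_monoid.a_assoc[OF monoid])
  next
    fix x y assume "x \<in> carrier ?V" "y \<in> carrier ?V"
    then show "x \<oplus>\<^bsub>?V\<^esub> y = y \<oplus>\<^bsub>?V\<^esub> x"
      by (intro eq add_mem) (auto simp: add mem abelian_monoid.a_comm[OF monoid])
  next
    fix x assume x: "x \<in> carrier ?V"
    then show "\<zero>\<^bsub>?V\<^esub> \<oplus>\<^bsub>?V\<^esub> x = x"
      by (intro eq add_mem zero_mem) (auto simp: add zero mem)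
    \<comment> \<open>The scalar multiple by -1 is the witness for the additive inverse.\<close>
    have "(- 1) \<odot>\<^bsub>?V\<^esub> x \<oplus>\<^bsub>?V\<^esub> x = \<zero>\<^bsub>?V\<^esub>"
      using x abelian_group.l_neg[OF ag]
      by (intro eq add_mem smult_mem zero_mem)
         (auto simp: add smult zero mem simp flip: vspace_uminus[OF bspec[OF E]])
    then show "\<exists>y\<in>carrier ?V. y \<oplus>\<^bsub>?V\<^esub> x = \<zero>\<^bsub>?V\<^esub>"
      using smult_mem[OF x] by blast
  qed (auto simp: add_mem zero_mem)
  moreover have "(a + b) \<odot>\<^bsub>?V\<^esub> x = a \<odot>\<^bsub>?V\<^esub> x \<oplus>\<^bsub>?V\<^esub> b \<odot>\<^bsub>?V\<^esub> x"
    if "x \<in> carrier ?V" for a b x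
    using that by (intro eq add_mem smult_mem) (auto simp: add smult mem vspace_smult_add_left E)
  moreover have "a \<odot>\<^bsub>?V\<^esub> (x \<oplus>\<^bsub>?V\<^esub> y) = a \<odot>\<^bsub>?V\<^esub> x \<oplus>\<^bsub>?V\<^esub> a \<odot>\<^bsub>?V\<^esub> y"
    if "x \<in> carrier ?V" "y \<in> carrier ?V" for a x y
    using that by (intro eq add_mem smult_mem) (auto simp: add smult mem vspace_smult_add_right E)
  moreover have "(a * b) \<odot>\<^bsub>?V\<^esub> x = a \<odot>\<^bsub>?V\<^esub> (b \<odot>\<^bsub>?V\<^esub> x)" if "x \<in> carrier ?V" for a b x
    using that by (intro eq smult_mem) (auto simp: smult mem vspace_smult_smult E)
  moreover have "1 \<odot>\<^bsub>?V\<^esub> x = x" if "x \<in> carrier ?V" for x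
    using that by (intro eq smult_mem) (auto simp: smult mem vspace_smult_one E)
  ultimately show ?thesis
    unfolding vspace_def
    by (intro moduleI cring_from_type_algebra)
       (auto simp: ring_of_type_algebra_def smult_mem)
qed

lemma direct_sum_minus:
  assumes "x \<in> carrier (direct_sum I E)" "y \<in> carrier (direct_sum I E)" "i \<in> I"
  shows "(y \<ominus>\<^bsub>direct_sum I E\<^esub> x) i = y i \<ominus>\<^bsub>E i\<^esub> x i"
proof -
  have "x i \<in> carrier (E i)"
    using assms unfolding carrier_finite_direct_sum[OF I] by auto
  then show ?thesis
    using assms by (simp add: vspace_minus[OF vspace_finite_direct_sum] vspace_minus[OF bspec[OF E]])
      (simp add: direct_sum_def)
qed

section \<open>The product topology as the finest one with continuous inclusions\<close>

lemma continuous_dsum_inclusion: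
  assumes T: "\<forall>i\<in>I. topspace (T i) = carrier (E i)" and j: "j \<in> I"
  shows "continuous_map (T j) (tau_0 I E T) (dsum_inclusion I E j)"
  unfolding tau_0_finite[OF I T] continuous_map_componentwise
proof (intro conjI ballI)
  show "dsum_inclusion I E j ` topspace (T j) \<subseteq> extensional I"
    by (auto simp: dsum_inclusion_def)
  fix i assume i: "i \<in> I"
  have "\<zero>\<^bsub>E i\<^esub> \<in> carrier (E i)"
    using vspace_abelian_group[OF bspec[OF E i]]
    by (simp add: abelian_group_def abelian_monoid.zero_closed)
  \<comment> \<open>The component is the identity for \<open>i = j\<close> and constantly zero
    otherwise.\<close>
  then show "continuous_map (T j) (T i) (\<lambda>x. dsum_inclusion I E j x i)"
    using i bspec[OF T i] by (cases "i = j") (simp_all add: dsum_inclusion_def)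
qed

text \<open>Induction over subsets \<open>J\<close> of \<open>I\<close> shows that truncating a
  point to the coordinates in \<open>J\<close> is continuous from the product into \<open>S\<close>.
  For \<open>J = I\<close> the truncation is the identity, and its continuity says that the product
  topology is finer.\<close>

lemma tau_0_finer:
  assumes T: "\<forall>i\<in>I. topspace (T i) = carrier (E i)"
    and S: "linear_topology (direct_sum I E) S"
    and incl: "\<And>i. i \<in> I \<Longrightarrow> continuous_map (T i) S (dsum_inclusion I E i)"
    and U: "openin S U"
  shows "openin (tau_0 I E T) U"
proof -
  let ?V = "direct_sum I E"
  let ?P = "product_topology T I"
  have top: "topspace ?P = carrier ?V"
    using T by (auto simp: carrier_finite_direct_sum[OF I] cong: PiE_cong)
  have topS: "topspace S = carrier ?V" using S by (simp add: linear_topology_def)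
  have monoid: "abelian_monoid (E i)" if "i \<in> I" for i
    using that E vspace_abelian_group by (blast intro: abelian_group.axioms)
  have "continuous_map ?P S (\<lambda>x. \<lambda>i\<in>I. if i \<in> J then x i else \<zero>\<^bsub>E i\<^esub>)"
    if "J \<subseteq> I" for J
    using finite_subset[OF that I] that
  proof (induction J rule: finite_induct)
    case empty
    have "(\<lambda>i\<in>I. \<zero>\<^bsub>E i\<^esub>) \<in> carrier ?V"
      using monoid abelian_monoid.zero_closed by (fastforce simp: carrier_finite_direct_sum[OF I])
    then show ?case by (simp add: topS restrict_def)
  next
    case (insert j J)
    then have j: "j \<in> I" by simp
    \<comment> \<open>The contribution of the new coordinate: projection to it followed by
      inclusion. Continuity of addition in \<open>S\<close> then joins it to the truncation already
      treated.\<close>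
    have "continuous_map ?P S (dsum_inclusion I E j \<circ> (\<lambda>x. x j))"
      using continuous_map_product_projection[OF j] incl[OF j] by (rule continuous_map_compose)
    then have "continuous_map ?P S (\<lambda>x. (\<lambda>i\<in>I. if i \<in> J then x i else \<zero>\<^bsub>E i\<^esub>)
        \<oplus>\<^bsub>?V\<^esub> dsum_inclusion I E j (x j))"
      using insert by (intro continuous_map_linear_add[OF vspace_finite_direct_sum S])
        (simp_all add: o_def restrict_def)
    then show ?case
    proof (rule continuous_map_eq)
      fix x assume "x \<in> topspace ?P"
      then have x: "x i \<in> carrier (E i)" if "i \<in> I" for i
        using that unfolding top carrier_finite_direct_sum[OF I] by auto
      \<comment> \<open>As \<open>j\<close> is not in \<open>J\<close>, the truncation is zero at
        \<open>j\<close> and the sum has exactly \<open>x j\<close> there.\<close>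
      show "(\<lambda>i\<in>I. if i \<in> J then x i else \<zero>\<^bsub>E i\<^esub>) \<oplus>\<^bsub>?V\<^esub> dsum_inclusion I E j (x j) =
          (\<lambda>i\<in>I. if i \<in> insert j J then x i else \<zero>\<^bsub>E i\<^esub>)"
        using insert.hyps x monoid
        by (auto simp: direct_sum_def dsum_inclusion_def fun_eq_iff restrict_def
            abelian_monoid.l_zero abelian_monoid.r_zero abelian_monoid.zero_closed)
    qed
  qed
  \<comment> \<open>Points of the product are extensional, so restricting them to \<open>I\<close>
    leaves them unchanged.\<close>
  from this[OF subset_refl] have "continuous_map ?P S (\<lambda>x. x)"
    by (rule continuous_map_eq)
       (auto simp: fun_eq_iff restrict_def PiE_def extensional_def)
  then have "openin ?P {x \<in> topspace ?P. x \<in> U}"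
    using U openin_continuous_map_preimage by blast
  moreover have "{x \<in> topspace ?P. x \<in> U} = U"
    using openin_subset[OF U] by (auto simp only: top topS)
  ultimately show ?thesis by (simp add: tau_0_finite[OF I T])
qed

end

section \<open>Sums of seminorms on finite direct sums\<close>

context
  fixes I :: "'i set" and E :: "'i \<Rightarrow> ('k::real_normed_field, 'a) module"
    and L :: "'i \<Rightarrow> 'l set" and \<nu> :: "'i \<Rightarrow> 'l \<Rightarrow> 'a \<Rightarrow> real"
  assumes I: "finite I" and E: "\<forall>i\<in>I. vspace (E i)"
    and dir: "\<forall>i\<in>I. directed_seminorms (E i) {\<nu> i l | l. l \<in> L i}"
begin

lemma component_seminorm: "i \<in> I \<Longrightarrow> l \<in> L i \<Longrightarrow> seminorm_on (E i) (\<nu> i l)"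
  using dir by (auto simp: directed_seminorms_def)

lemma mu_hat_apply: "mu_hat I \<nu> \<rho> x = (\<Sum>i\<in>I. \<nu> i (\<rho> i) (x i))"
  by (simp add: mu_hat_def nu_hat_def proj_def)

lemma seminorm_on_mu_hat:
  assumes \<rho>: "\<rho> \<in> Pi\<^sub>E I L"
  shows "seminorm_on (direct_sum I E) (mu_hat I \<nu> \<rho>)"
proof -
  let ?V = "direct_sum I E"
  have sn: "seminorm_on (E i) (\<nu> i (\<rho> i))" if "i \<in> I" for i
    using that \<rho> component_seminorm by auto
  have mem: "x i \<in> carrier (E i)" if "x \<in> carrier ?V" "i \<in> I" for x i
    using that unfolding carrier_finite_direct_sum[OF I] by auto
  show ?thesis
    unfolding seminorm_on_def
  proof (intro conjI ballI allI)
    fix x assume x: "x \<in> carrier ?V"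
    show "0 \<le> mu_hat I \<nu> \<rho> x"
      unfolding mu_hat_apply using x sn mem by (intro sum_nonneg) (auto simp: seminorm_on_def)
    show "mu_hat I \<nu> \<rho> (a \<odot>\<^bsub>?V\<^esub> x) = norm a * mu_hat I \<nu> \<rho> x" for a
      unfolding mu_hat_apply sum_distrib_left using x sn mem
      by (intro sum.cong) (auto simp: seminorm_on_def direct_sum_def)
    fix y assume y: "y \<in> carrier ?V"
    show "mu_hat I \<nu> \<rho> (x \<oplus>\<^bsub>?V\<^esub> y) \<le> mu_hat I \<nu> \<rho> x + mu_hat I \<nu> \<rho> y"
      unfolding mu_hat_apply sum.distrib[symmetric]
    proof (rule sum_mono)
      fix i assume i: "i \<in> I"
      then show "\<nu> i (\<rho> i) ((x \<oplus>\<^bsub>?V\<^esub> y) i) \<le> \<nu> i (\<rho> i) (x i) + \<nu> i (\<rho> i) (y i)"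
        using sn[OF i] mem[OF x i] mem[OF y i] by (simp add: seminorm_on_def direct_sum_def)
    qed
  qed
qed

text \<open>In each factor an index dominating the two given ones is chosen; summing the
  inequalities over \<open>I\<close> shows that the chosen family dominates both sums.\<close>

lemma directed_mu_hat:
  "directed_seminorms (direct_sum I E) {mu_hat I \<nu> \<rho> | \<rho>. \<rho> \<in> Pi\<^sub>E I L}"
  unfolding directed_seminorms_def
proof (intro conjI ballI)
  \<comment> \<open>Nonemptiness of each \<open>L i\<close> passes to the product. For empty
    \<open>I\<close> the product still has one element, and the only sum is the zero
    seminorm.\<close>
  have "L i \<noteq> {}" if "i \<in> I" for i
    using bspec[OF dir that] by (auto simp: directed_seminorms_def)
  then have "Pi\<^sub>E I L \<noteq> {}" by (simp add: PiE_eq_empty_iff)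
  then show "{mu_hat I \<nu> \<rho> | \<rho>. \<rho> \<in> Pi\<^sub>E I L} \<noteq> {}" by blast
next
  fix p assume "p \<in> {mu_hat I \<nu> \<rho> | \<rho>. \<rho> \<in> Pi\<^sub>E I L}"
  then show "seminorm_on (direct_sum I E) p" using seminorm_on_mu_hat by blast
next
  fix p q
  assume "p \<in> {mu_hat I \<nu> \<rho> | \<rho>. \<rho> \<in> Pi\<^sub>E I L}" "q \<in> {mu_hat I \<nu> \<rho> | \<rho>. \<rho> \<in> Pi\<^sub>E I L}"
  then obtain \<rho> \<sigma> where \<rho>: "\<rho> \<in> Pi\<^sub>E I L" "p = mu_hat I \<nu> \<rho>" and \<sigma>: "\<sigma> \<in> Pi\<^sub>E I L" "q = mu_hat I \<nu> \<sigma>"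
    by blast
  have "\<exists>l\<in>L i. \<forall>x\<in>carrier (E i). \<nu> i (\<rho> i) x \<le> \<nu> i l x \<and> \<nu> i (\<sigma> i) x \<le> \<nu> i l x" if i: "i \<in> I" for i
  proof -
    have "\<nu> i (\<rho> i) \<in> {\<nu> i l | l. l \<in> L i}" "\<nu> i (\<sigma> i) \<in> {\<nu> i l | l. l \<in> L i}"
      using \<rho> \<sigma> i by auto
    then obtain r where "r \<in> {\<nu> i l | l. l \<in> L i}"
      "\<forall>x\<in>carrier (E i). \<nu> i (\<rho> i) x \<le> r x \<and> \<nu> i (\<sigma> i) x \<le> r x"
      using bspec[OF dir i] unfolding directed_seminorms_def by blast
    then show ?thesis by blast
  qed
  then obtain \<kappa> where \<kappa>: "\<And>i. i \<in> I \<Longrightarrow> \<kappa> i \<in> L i"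
    "\<And>i x. i \<in> I \<Longrightarrow> x \<in> carrier (E i) \<Longrightarrow> \<nu> i (\<rho> i) x \<le> \<nu> i (\<kappa> i) x \<and> \<nu> i (\<sigma> i) x \<le> \<nu> i (\<kappa> i) x"
    by metis
  have "mu_hat I \<nu> (restrict \<kappa> I) \<in> {mu_hat I \<nu> \<rho> | \<rho>. \<rho> \<in> Pi\<^sub>E I L}"
    using \<kappa>(1) by (fastforce intro!: exI[of _ "restrict \<kappa> I"])
  moreover have "p x \<le> mu_hat I \<nu> (restrict \<kappa> I) x \<and> q x \<le> mu_hat I \<nu> (restrict \<kappa> I) x"
    if "x \<in> carrier (direct_sum I E)" for x
    using that \<kappa>(2) unfolding \<rho>(2) \<sigma>(2) mu_hat_apply carrier_finite_direct_sum[OF I]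
    by (auto intro!: sum_mono)
  ultimately show "\<exists>r\<in>{mu_hat I \<nu> \<rho> | \<rho>. \<rho> \<in> Pi\<^sub>E I L}.
      \<forall>x\<in>carrier (direct_sum I E). p x \<le> r x \<and> q x \<le> r x"
    by blast
qed

text \<open>The open sets are compared point by point: around each point a ball of a sum seminorm
  contains an open box, and an open box contains such a ball.\<close>

lemma seminorm_topology_mu_hat:
  assumes T: "\<forall>i\<in>I. T i = seminorm_topology (E i) {\<nu> i l | l. l \<in> L i}"
  shows "seminorm_topology (direct_sum I E) {mu_hat I \<nu> \<rho> | \<rho>. \<rho> \<in> Pi\<^sub>E I L} = tau_0 I E T"
    (is "?\<tau> = _")
proof -
  let ?V = "direct_sum I E"
  note VV = vspace_finite_direct_sum[OF I E]
  note car = carrier_finite_direct_sum[OF I]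
  have topT: "\<forall>i\<in>I. topspace (T i) = carrier (E i)"
    using T E by (simp add: topspace_seminorm_topology)
  have tau0: "tau_0 I E T = product_topology T I"
    by (rule tau_0_finite[OF I topT])
  have diff: "y i \<ominus>\<^bsub>E i\<^esub> x i \<in> carrier (E i)" "x i \<in> carrier (E i)"
    if "x \<in> carrier ?V" "y \<in> carrier ?V" "i \<in> I" for x y i
    using that abelian_group.minus_closed[OF vspace_abelian_group[OF bspec[OF E]]]
    by (simp_all add: car PiE_iff)
  have mu_diff: "mu_hat I \<nu> \<rho> (y \<ominus>\<^bsub>?V\<^esub> x) = (\<Sum>i\<in>I. \<nu> i (\<rho> i) (y i \<ominus>\<^bsub>E i\<^esub> x i))"
    if "x \<in> carrier ?V" "y \<in> carrier ?V" for \<rho> x y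
    unfolding mu_hat_apply using that by (intro sum.cong) (simp_all add: direct_sum_minus[OF I E])
  have "openin ?\<tau> U \<longleftrightarrow> openin (product_topology T I) U" for U
  proof
    assume U: "openin ?\<tau> U"
    show "openin (product_topology T I) U"
    proof (subst openin_subopen, intro ballI)
      fix x assume x: "x \<in> U"
      obtain \<rho> \<epsilon> where \<rho>: "\<rho> \<in> Pi\<^sub>E I L" "\<epsilon> > 0" "seminorm_ball ?V (mu_hat I \<nu> \<rho>) x \<epsilon> \<subseteq> U"
        using U x by (auto simp: openin_seminorm_topology[OF VV directed_mu_hat])
      have xV: "x \<in> carrier ?V"
        using U x by (auto simp: openin_seminorm_topology[OF VV directed_mu_hat])
      \<comment> \<open>The sum of \<open>card I\<close> terms, each at most \<delta>, must stay
        strictly below \<epsilon>. The extra 1 gives strictness and avoids division by zero when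
        \<open>I\<close> is empty.\<close>
      define \<delta> where "\<delta> = \<epsilon> / (real (card I) + 1)"
      have \<delta>: "\<delta> > 0" using \<rho> by (simp add: \<delta>_def)
      let ?B = "\<lambda>i. seminorm_ball (E i) (\<nu> i (\<rho> i)) (x i) \<delta>"
      have "openin (T i) (?B i)" if i: "i \<in> I" for i
        unfolding bspec[OF T i] using \<rho> i diff(2)[OF xV xV] \<delta>
        by (intro openin_seminorm_ball) (auto simp: E)
      then have "openin (product_topology T I) (Pi\<^sub>E I ?B)"
        using I by (simp add: openin_PiE)
      moreover have "x \<in> Pi\<^sub>E I ?B"
        using xV \<rho> \<delta> diff(2)[OF xV xV]
        by (auto simp: car E intro!: seminorm_ball_center component_seminorm)
      moreover have "Pi\<^sub>E I ?B \<subseteq> U"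
      proof
        fix y assume y: "y \<in> Pi\<^sub>E I ?B"
        then have yV: "y \<in> carrier ?V" by (auto simp: car seminorm_ball_def)
        have "mu_hat I \<nu> \<rho> (y \<ominus>\<^bsub>?V\<^esub> x) \<le> (\<Sum>i\<in>I. \<delta>)"
          unfolding mu_diff[OF xV yV] using y
          by (intro sum_mono) (auto simp: seminorm_ball_def PiE_iff less_imp_le)
        also have "\<dots> < \<epsilon>"
          using \<rho>(2) by (simp add: \<delta>_def field_simps)
        finally show "y \<in> U"
          using \<rho>(3) yV by (auto simp: seminorm_ball_def)
      qed
      ultimately show "\<exists>W. openin (product_topology T I) W \<and> x \<in> W \<and> W \<subseteq> U" by blast
    qed
  next
    assume U: "openin (product_topology T I) U"
    have "\<exists>\<rho>\<in>Pi\<^sub>E I L. \<exists>\<epsilon>>0. seminorm_ball ?V (mu_hat I \<nu> \<rho>) x \<epsilon> \<subseteq> U" if x: "x \<in> U" for x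
    proof -
      obtain N where N: "\<And>i. i \<in> I \<Longrightarrow> openin (T i) (N i)" "x \<in> Pi\<^sub>E I N" "Pi\<^sub>E I N \<subseteq> U"
        using U x unfolding openin_product_topology_alt by metis
      have "\<exists>l\<in>L i. \<exists>\<epsilon>>0. seminorm_ball (E i) (\<nu> i l) (x i) \<epsilon> \<subseteq> N i" if i: "i \<in> I" for i
      proof -
        have "x i \<in> N i" using N(2) i by auto
        then show ?thesis
          using N(1)[OF i]
          unfolding bspec[OF T i] openin_seminorm_topology[OF bspec[OF E i] bspec[OF dir i]]
          by blast
      qed
      then obtain \<rho> \<epsilon> where \<rho>: "\<And>i. i \<in> I \<Longrightarrow> \<rho> i \<in> L i" "\<And>i. i \<in> I \<Longrightarrow> \<epsilon> i > (0::real)"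
        "\<And>i. i \<in> I \<Longrightarrow> seminorm_ball (E i) (\<nu> i (\<rho> i)) (x i) (\<epsilon> i) \<subseteq> N i"
        by metis
      \<comment> \<open>One radius for all factors, available because \<open>I\<close> is finite.
        Inserting 1 keeps the minimum meaningful and positive for empty \<open>I\<close>.\<close>
      define \<delta> where "\<delta> = Min (insert 1 (\<epsilon> ` I))"
      have \<delta>: "\<delta> > 0" "\<And>i. i \<in> I \<Longrightarrow> \<delta> \<le> \<epsilon> i"
        using I \<rho>(2) by (auto simp: \<delta>_def)
      have xV: "x \<in> carrier ?V"
        using openin_subset[OF U] x topT by (auto simp: car PiE_iff)
      have "seminorm_ball ?V (mu_hat I \<nu> (restrict \<rho> I)) x \<delta> \<subseteq> Pi\<^sub>E I N"
      proof
        fix y assume "y \<in> seminorm_ball ?V (mu_hat I \<nu> (restrict \<rho> I)) x \<delta>"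
        then have yV: "y \<in> carrier ?V" and y: "(\<Sum>i\<in>I. \<nu> i (\<rho> i) (y i \<ominus>\<^bsub>E i\<^esub> x i)) < \<delta>"
          using mu_diff[OF xV] by (auto simp: seminorm_ball_def)
        have "y i \<in> N i" if i: "i \<in> I" for i
        proof -
          \<comment> \<open>All summands are nonnegative, so each one is bounded by the whole
            sum.\<close>
          have "\<nu> i (\<rho> i) (y i \<ominus>\<^bsub>E i\<^esub> x i) \<le> (\<Sum>i\<in>I. \<nu> i (\<rho> i) (y i \<ominus>\<^bsub>E i\<^esub> x i))"
          proof (rule member_le_sum[OF i _ I])
            fix j assume "j \<in> I - {i}"
            then show "0 \<le> \<nu> j (\<rho> j) (y j \<ominus>\<^bsub>E j\<^esub> x j)"
              using component_seminorm[of j "\<rho> j"] \<rho>(1) diff(1)[OF xV yV]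
              by (auto simp: seminorm_on_def)
          qed
          then have "\<nu> i (\<rho> i) (y i \<ominus>\<^bsub>E i\<^esub> x i) < \<epsilon> i"
            using y \<delta>(2)[OF i] by simp
          then show ?thesis
            using \<rho>(3)[OF i] diff(2)[OF yV yV i] by (auto simp: seminorm_ball_def)
        qed
        then show "y \<in> Pi\<^sub>E I N" using yV by (auto simp: car PiE_iff)
      qed
      then show ?thesis
        using N(3) \<delta>(1) \<rho>(1) by (intro bexI[of _ "restrict \<rho> I"] exI[of _ \<delta>]) auto
    qed
    moreover have "U \<subseteq> carrier ?V"
      using openin_subset[OF U] topT by (auto simp: car PiE_iff)
    ultimately show "openin ?\<tau> U"
      unfolding openin_seminorm_topology[OF VV directed_mu_hat] by blast
  qed
  then show ?thesis by (simp add: topology_eq tau0)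
qed

end

section \<open>Uniqueness and coincidence of the topologies on the finite direct sum\<close>

theorem theorem1p3p1:
  fixes n :: nat
    and E :: "nat \<Rightarrow> ('k::real_normed_field, 'a) module"
    and T :: "nat \<Rightarrow> 'a topology"
    and L :: "nat \<Rightarrow> 'l set"
    and \<nu> :: "nat \<Rightarrow> 'l \<Rightarrow> 'a \<Rightarrow> real"
  assumes "\<And>i. i \<in> {1..n} \<Longrightarrow> locally_convex_topology (E i) (T i)"
    and "\<And>i. i \<in> {1..n} \<Longrightarrow>
           fundamental_directed_seminorms (E i) (T i) {\<nu> i l | l. l \<in> L i}"
  shows "let I = {1..n};
             V = direct_sum I E;
             R = (\<Pi>\<^sub>E i\<in>I. L i);
             \<mu> = {mu_hat I \<nu> \<rho> | \<rho>. \<rho> \<in> R};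
             W = (\<lambda>\<rho> \<epsilon>. {x \<in> carrier V. mu_hat I \<nu> \<rho> x < \<epsilon>});
             \<B> = {W \<rho> \<epsilon> | \<rho> \<epsilon>. (0::real) < \<epsilon> \<and> \<rho> \<in> R};
             \<tau> = seminorm_topology V \<mu>
         in directed_seminorms V \<mu>
          \<and> locally_convex_topology V \<tau>
          \<and> filter_base (nhdsin \<tau> \<zero>\<^bsub>V\<^esub>) \<B>
          \<and> (\<forall>S. locally_convex_topology V S \<and> filter_base (nhdsin S \<zero>\<^bsub>V\<^esub>) \<B> \<longrightarrow> S = \<tau>)
          \<and> \<tau> = tau_0 I E T
          \<and> \<tau> = tau_b I E T
          \<and> is_tau_l I E T \<tau>
          \<and> is_tau_lc I E T \<tau>"
proof -
  define I where "I = {1..n}"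
  define V where "V = direct_sum I E"
  define \<mu> where "\<mu> = {mu_hat I \<nu> \<rho> | \<rho>. \<rho> \<in> Pi\<^sub>E I L}"
  define \<B> where "\<B> = {{x \<in> carrier V. mu_hat I \<nu> \<rho> x < \<epsilon>} | \<rho> \<epsilon>. (0::real) < \<epsilon> \<and> \<rho> \<in> Pi\<^sub>E I L}"
  define \<tau> where "\<tau> = seminorm_topology V \<mu>"
  have I: "finite I" by (simp add: I_def)
  have E: "\<forall>i\<in>I. vspace (E i)" and topT: "\<forall>i\<in>I. topspace (T i) = carrier (E i)"
    using assms(1) by (auto simp: I_def locally_convex_topology_def linear_topology_def)
  have dir: "\<forall>i\<in>I. directed_seminorms (E i) {\<nu> i l | l. l \<in> L i}"
    and T: "\<forall>i\<in>I. T i = seminorm_topology (E i) {\<nu> i l | l. l \<in> L i}"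
    using assms(2) by (auto simp: I_def fundamental_directed_seminorms_def)
  have V: "vspace V"
    unfolding V_def by (rule vspace_finite_direct_sum[OF I E])
  have \<mu>: "directed_seminorms V \<mu>"
    unfolding V_def \<mu>_def by (rule directed_mu_hat[OF I E dir])
  have lc: "locally_convex_topology V \<tau>"
    unfolding \<tau>_def by (rule locally_convex_seminorm_topology[OF V \<mu>])
  \<comment> \<open>The base is reindexed by the seminorms themselves instead of by \<rho>, to match
    \<open>filter_base_seminorm_topology\<close>.\<close>
  have "\<B> = {{x \<in> carrier V. p x < \<epsilon>} | p \<epsilon>. 0 < \<epsilon> \<and> p \<in> \<mu>}"
    unfolding \<B>_def \<mu>_def by blast
  then have base: "filter_base (nhdsin \<tau> \<zero>\<^bsub>V\<^esub>) \<B>"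
    unfolding \<tau>_def using filter_base_seminorm_topology[OF V \<mu>] by simp
  have unique: "S = \<tau>" if "locally_convex_topology V S" "filter_base (nhdsin S \<zero>\<^bsub>V\<^esub>) \<B>" for S
    using linear_topology_eqI[OF V _ _ that(2) base] that(1) lc
    by (simp add: locally_convex_topology_def)
  have tau_0: "\<tau> = tau_0 I E T"
    unfolding \<tau>_def V_def \<mu>_def by (rule seminorm_topology_mu_hat[OF I E dir T])
  have incl: "continuous_map (T i) \<tau> (dsum_inclusion I E i)" if "i \<in> I" for i
    unfolding tau_0 by (rule continuous_dsum_inclusion[OF I E topT that])
  \<comment> \<open>Stated for linear topologies \<open>S\<close>, this covers both maximality
    claims, since locally convex topologies are linear.\<close>
  have finer: "openin \<tau> U"
    if "linear_topology V S" "\<forall>i\<in>I. continuous_map (T i) S (dsum_inclusion I E i)" "openin S U"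
    for S U
    unfolding tau_0 by (rule tau_0_finer[OF I E topT that(1)[unfolded V_def]]) (use that in auto)
  \<comment> \<open>As \<tau> is itself locally convex, it is a competitor in both classes and hence
    the finest member of each.\<close>
  have "is_tau_l I E T \<tau>" "is_tau_lc I E T \<tau>"
    using lc incl finer
    unfolding is_tau_l_def is_tau_lc_def is_finest_topology_def locally_convex_topology_def V_def
    by blast+
  moreover have "\<tau> = tau_b I E T"
    unfolding tau_0 by (simp add: tau_b_eq_tau_0[OF I])
  ultimately have "directed_seminorms V \<mu> \<and> locally_convex_topology V \<tau> \<and>
      filter_base (nhdsin \<tau> \<zero>\<^bsub>V\<^esub>) \<B> \<and>
      (\<forall>S. locally_convex_topology V S \<and> filter_base (nhdsin S \<zero>\<^bsub>V\<^esub>) \<B> \<longrightarrow> S = \<tau>) \<and>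
      \<tau> = tau_0 I E T \<and> \<tau> = tau_b I E T \<and> is_tau_l I E T \<tau> \<and> is_tau_lc I E T \<tau>"
    using \<mu> lc base unique tau_0 by blast
  then show ?thesis
    unfolding Let_def \<B>_def \<tau>_def \<mu>_def V_def I_def .
qed

end
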